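(* Let $\Phi$ be a multiflow over a compact Hausdorff space $X$. Let $A$ be an attractor for $\Phi$ and let $V$ be a neighborhood of $A$. Then there exists a closed attracting neighborhood $B\subset V$ associated with $A$.
   Context: A multiflow over a topological space $X$ is a closed subset $\Phi\subset[0,\infty)\times X\times X$ such that, writing $\Phi^t=\{(x,y):(t,x,y)\in\Phi\}$, one has $\Phi^0=\mathrm{id}_X=\{(x,x):x\in X\}$ and $\Phi^{s+t}=\Phi^s\circ\Phi^t$ (composition of relations) for all $s,t\ge 0$. For $S\subset X$, $\Phi^t(S)=\{y\in X:\exists x\in S,\ (x,y)\in\Phi^t\}$. A set $K\subset X$ is confining for $\Phi$ if $\Phi^t(K)\subset K$ for all $t\ge0$; it is invariant for $\Phi$ if $\Phi^t(K)=K$ for all $t\ge0$; it is eventually strictly confining for $\Phi$ if there is $T>0$ with $\Phi^t(K)\subset\operatorname{int}(K)$ for all $t\ge T$. For $U\subset X$, let $\mathfrak K(U;\Phi)$ be the set of all closed $K\subset X$ that are confining for $\Phi$ and such that $\Phi^t(U)\subset K$ for some $t>0$. The omega limit set is $\omega(U;\Phi)=\bigcap_{K\in\mathfrak K(U;\Phi)}K$. A neighborhood of a set $A$ is a set whose interior contains $A$. An attractor for $\Phi$ is a compact invariant set $A$ that has a compact neighborhood $U$ with $\omega(U;\Phi)=A$. A set $B$ is an attracting neighborhood associated to $A$ if $B$ is a compact neighborhood of $A$, $\omega(B;\Phi)=A$, and $B$ is eventually strictly confining for $\Phi$. *)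

theory Defs
  imports "HOL-Analysis.Analysis"
begin

definition time_rel :: "(real \<times> 'a \<times> 'a) set \<Rightarrow> real \<Rightarrow> ('a \<times> 'a) set" where
  "time_rel \<Phi> t = {(x, y). (t, x, y) \<in> \<Phi>}"

text \<open>
  The relation composition \<open>O\<close> applies its left argument first, so
  \<open>\<Phi>\<^sup>s \<circ> \<Phi>\<^sup>t\<close> (first \<open>\<Phi>\<^sup>t\<close>, then \<open>\<Phi>\<^sup>s\<close>) is
  \<open>time_rel \<Phi> t O time_rel \<Phi> s\<close>. The image \<open>\<Phi>\<^sup>t(S)\<close> is
  \<open>time_rel \<Phi> t `` S\<close>.
\<close>
definition multiflow :: "'a topology \<Rightarrow> (real \<times> 'a \<times> 'a) set \<Rightarrow> bool" where
  "multiflow X \<Phi> \<longleftrightarrow>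
     closedin (prod_topology (top_of_set {0..}) (prod_topology X X)) \<Phi> \<and>
     time_rel \<Phi> 0 = Id_on (topspace X) \<and>
     (\<forall>s\<ge>0. \<forall>t\<ge>0. time_rel \<Phi> (s + t) = time_rel \<Phi> t O time_rel \<Phi> s)"

definition confining :: "'a topology \<Rightarrow> (real \<times> 'a \<times> 'a) set \<Rightarrow> 'a set \<Rightarrow> bool" where
  "confining X \<Phi> K \<longleftrightarrow> K \<subseteq> topspace X \<and> (\<forall>t\<ge>0. time_rel \<Phi> t `` K \<subseteq> K)"

definition invariant :: "'a topology \<Rightarrow> (real \<times> 'a \<times> 'a) set \<Rightarrow> 'a set \<Rightarrow> bool" where
  "invariant X \<Phi> K \<longleftrightarrow> K \<subseteq> topspace X \<and> (\<forall>t\<ge>0. time_rel \<Phi> t `` K = K)"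

definition eventually_strictly_confining ::
    "'a topology \<Rightarrow> (real \<times> 'a \<times> 'a) set \<Rightarrow> 'a set \<Rightarrow> bool" where
  "eventually_strictly_confining X \<Phi> K \<longleftrightarrow>
     K \<subseteq> topspace X \<and> (\<exists>T>0. \<forall>t\<ge>T. time_rel \<Phi> t `` K \<subseteq> X interior_of K)"

definition confining_family ::
    "'a topology \<Rightarrow> (real \<times> 'a \<times> 'a) set \<Rightarrow> 'a set \<Rightarrow> 'a set set" where
  "confining_family X \<Phi> U =
     {K. closedin X K \<and> confining X \<Phi> K \<and> (\<exists>t>0. time_rel \<Phi> t `` U \<subseteq> K)}"

text \<open>
  For a multiflow the family always contains \<open>topspace X\<close>, so the intersection
  below is never taken over the empty family.
\<close>
definition omega_limit ::
    "'a topology \<Rightarrow> (real \<times> 'a \<times> 'a) set \<Rightarrow> 'a set \<Rightarrow> 'a set" where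
  "omega_limit X \<Phi> U = \<Inter> (confining_family X \<Phi> U)"

text \<open>Neighborhoods of sets need not be open.\<close>
definition neighborhood_of_set :: "'a topology \<Rightarrow> 'a set \<Rightarrow> 'a set \<Rightarrow> bool" where
  "neighborhood_of_set X A U \<longleftrightarrow> U \<subseteq> topspace X \<and> A \<subseteq> X interior_of U"

definition attractor :: "'a topology \<Rightarrow> (real \<times> 'a \<times> 'a) set \<Rightarrow> 'a set \<Rightarrow> bool" where
  "attractor X \<Phi> A \<longleftrightarrow>
     compactin X A \<and> invariant X \<Phi> A \<and>
     (\<exists>U. compactin X U \<and> neighborhood_of_set X A U \<and> omega_limit X \<Phi> U = A)"

definition attracting_neighborhood ::
    "'a topology \<Rightarrow> (real \<times> 'a \<times> 'a) set \<Rightarrow> 'a set \<Rightarrow> 'a set \<Rightarrow> bool" where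
  "attracting_neighborhood X \<Phi> A B \<longleftrightarrow>
     compactin X B \<and> neighborhood_of_set X A B \<and> omega_limit X \<Phi> B = A \<and>
     eventually_strictly_confining X \<Phi> B"

end

theory Submission
  imports Defs
begin

text \<open>
  By compactness some member \<open>K\<close> of the confining family of the compact neighborhood \<open>U\<close>
  of \<open>A\<close> lies in the interior of \<open>U \<inter> V\<close>. It need not be a neighborhood of \<open>A\<close>, but
  normality yields a closed neighborhood \<open>B \<subseteq> U \<inter> V\<close> of \<open>K\<close>, and since \<open>B \<subseteq> U\<close> is eventually
  carried into \<open>K\<close>, it is eventually strictly confining.
\<close>

text \<open>Closure under binary intersection makes the family directed downwards. If every member
  met the complement of \<open>W\<close>, that complement together with the family would have the
  finite intersection property, and compactness would give a point of \<open>\<Inter>\<F>\<close>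
  outside \<open>W\<close>.\<close>

lemma compact_space_closed_family_subset:
  assumes "compact_space X" and "\<F> \<noteq> {}" and "\<And>C. C \<in> \<F> \<Longrightarrow> closedin X C"
    and inter: "\<And>C D. C \<in> \<F> \<Longrightarrow> D \<in> \<F> \<Longrightarrow> C \<inter> D \<in> \<F>"
    and "openin X W" and "\<Inter>\<F> \<subseteq> W"
  shows "\<exists>K\<in>\<F>. K \<subseteq> W"
proof (rule ccontr)
  assume no: "\<not> (\<exists>K\<in>\<F>. K \<subseteq> W)"
  have fin: "\<Inter>\<G> \<in> \<F>" if "finite \<G>" "\<G> \<noteq> {}" "\<G> \<subseteq> \<F>" for \<G>
    using that by (induction \<G> rule: finite_ne_induct) (simp_all add: inter)
  let ?\<H> = "insert (topspace X - W) \<F>"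
  have "\<Inter>\<G> \<noteq> {}" if \<G>: "finite \<G>" "\<G> \<subseteq> ?\<H>" for \<G>
  proof -
    \<comment> \<open>\<open>\<G>\<close> may contain nothing but the complement of
      \<open>W\<close>; adding \<open>C\<^sub>0\<close> keeps the finite family passed to
      \<open>fin\<close> nonempty.\<close>
    obtain C\<^sub>0 where "C\<^sub>0 \<in> \<F>"
      using \<open>\<F> \<noteq> {}\<close> by blast
    define C where "C = \<Inter>(insert C\<^sub>0 (\<G> - {topspace X - W}))"
    have "C \<in> \<F>"
      unfolding C_def using \<G> \<open>C\<^sub>0 \<in> \<F>\<close> by (intro fin) auto
    then have "C \<inter> (topspace X - W) \<noteq> {}"
      using no closedin_subset[OF assms(3)] by blast
    moreover have "C \<inter> (topspace X - W) \<subseteq> \<Inter>\<G>"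
      by (auto simp: C_def)
    ultimately show ?thesis by auto
  qed
  moreover have "\<forall>C\<in>?\<H>. closedin X C"
    using assms by auto
  ultimately have "\<Inter>?\<H> \<noteq> {}"
    using \<open>compact_space X\<close> unfolding compact_space_fip by metis
  then show False
    using \<open>\<Inter>\<F> \<subseteq> W\<close> by auto
qed

lemma time_rel_Image_subset_topspace:
  assumes "multiflow X \<Phi>"
  shows "time_rel \<Phi> t `` S \<subseteq> topspace X"
proof -
  have "\<Phi> \<subseteq> {0..} \<times> topspace X \<times> topspace X"
    using assms unfolding multiflow_def by (auto dest!: closedin_subset)
  then show ?thesis
    by (auto simp: time_rel_def)
qed

text \<open>Split \<open>s\<close> as \<open>(s - t) + t\<close>: by time \<open>t\<close> the image
  is in \<open>K\<close>, and \<open>K\<close> is never left again. Thus the single entry time in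
  \<open>confining_family\<close> can be replaced by any later one.\<close>

lemma time_rel_Image_confining:
  assumes "multiflow X \<Phi>" and "confining X \<Phi> K"
    and "time_rel \<Phi> t `` U \<subseteq> K" and "0 \<le> t" and "t \<le> s"
  shows "time_rel \<Phi> s `` U \<subseteq> K"
proof -
  have "\<forall>a\<ge>0. \<forall>b\<ge>0. time_rel \<Phi> (a + b) = time_rel \<Phi> b O time_rel \<Phi> a"
    using assms(1) by (simp add: multiflow_def)
  then have "time_rel \<Phi> ((s - t) + t) = time_rel \<Phi> t O time_rel \<Phi> (s - t)"
    using assms(4,5) diff_ge_0_iff_ge by blast
  then have "time_rel \<Phi> s `` U = time_rel \<Phi> (s - t) `` (time_rel \<Phi> t `` U)"
    by (simp add: relcomp_Image)
  also have "\<dots> \<subseteq> time_rel \<Phi> (s - t) `` K"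
    using assms(3) by blast
  also have "\<dots> \<subseteq> K"
    using assms(2,5) by (simp add: confining_def)
  finally show ?thesis .
qed

text \<open>Supplies the nonemptiness needed for the compactness argument. Any positive entry time
  would do; 1 is arbitrary.\<close>

lemma topspace_in_confining_family:
  assumes "multiflow X \<Phi>"
  shows "topspace X \<in> confining_family X \<Phi> U"
  using time_rel_Image_subset_topspace[OF assms]
  by (auto simp: confining_family_def confining_def intro!: exI[of _ 1])

text \<open>At the later of the two entry times the image of \<open>U\<close> lies in both
  sets.\<close>

lemma confining_family_Int:
  assumes "multiflow X \<Phi>" and "C \<in> confining_family X \<Phi> U" and "D \<in> confining_family X \<Phi> U"
  shows "C \<inter> D \<in> confining_family X \<Phi> U"
proof -
  obtain s t where "s > 0" "time_rel \<Phi> s `` U \<subseteq> C" "t > 0" "time_rel \<Phi> t `` U \<subseteq> D"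
    using assms(2,3) by (auto simp: confining_family_def)
  then have "time_rel \<Phi> (max s t) `` U \<subseteq> C" "time_rel \<Phi> (max s t) `` U \<subseteq> D"
    using time_rel_Image_confining[OF assms(1)] assms(2,3)
    by (simp_all add: confining_family_def)
  moreover have "confining X \<Phi> (C \<inter> D)"
    using assms(2,3) unfolding confining_family_def confining_def by blast
  ultimately show ?thesis
    using assms(2,3) \<open>s > 0\<close>
    by (auto simp: confining_family_def intro!: exI[of _ "max s t"])
qed

text \<open>A smaller set is absorbed by more sets \<open>K\<close>, so its intersection runs over a
  larger family.\<close>

lemma omega_limit_mono:
  assumes "B \<subseteq> U"
  shows "omega_limit X \<Phi> B \<subseteq> omega_limit X \<Phi> U"
proof -
  have "confining_family X \<Phi> U \<subseteq> confining_family X \<Phi> B"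
    using assms unfolding confining_family_def by blast
  then show ?thesis
    unfolding omega_limit_def by blast
qed

text \<open>Flowing for the entry time \<open>t\<close> of \<open>K\<close> returns \<open>A\<close>
  itself, as a part of the image of \<open>B\<close>.\<close>

lemma invariant_subset_omega_limit:
  assumes "invariant X \<Phi> A" and "A \<subseteq> B"
  shows "A \<subseteq> omega_limit X \<Phi> B"
  unfolding omega_limit_def
proof (rule Inter_greatest)
  fix K assume "K \<in> confining_family X \<Phi> B"
  then obtain t where "t > 0" "time_rel \<Phi> t `` B \<subseteq> K"
    by (auto simp: confining_family_def)
  moreover have "time_rel \<Phi> t `` A = A"
    using assms(1) \<open>t > 0\<close> by (simp add: invariant_def)
  ultimately show "A \<subseteq> K"
    using assms(2) by blast
qed

theorem theorem5p33:
  fixes X :: "'a topology" and \<Phi> :: "(real \<times> 'a \<times> 'a) set" and A V :: "'a set"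
  assumes "compact_space X" and "Hausdorff_space X"
    and "multiflow X \<Phi>"
    and "attractor X \<Phi> A"
    and "neighborhood_of_set X A V"
  shows "\<exists>B. closedin X B \<and> attracting_neighborhood X \<Phi> A B \<and> B \<subseteq> V"
proof -
  obtain U where inv: "invariant X \<Phi> A" and nbU: "neighborhood_of_set X A U"
    and omU: "omega_limit X \<Phi> U = A"
    using assms(4) by (auto simp: attractor_def)
  \<comment> \<open>The factor from \<open>U\<close> lets \<open>B\<close> inherit the entry time of
    \<open>U\<close>; the factor from \<open>V\<close> gives \<open>B \<subseteq> V\<close>.\<close>
  define W where "W = X interior_of U \<inter> X interior_of V"
  have "openin X W" and "A \<subseteq> W" and "W \<subseteq> U" and "W \<subseteq> V"
    using nbU assms(5) interior_of_subset[of X]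
    by (auto simp: W_def neighborhood_of_set_def)
  have "\<exists>K\<in>confining_family X \<Phi> U. K \<subseteq> W"
  proof (rule compact_space_closed_family_subset[OF assms(1)])
    show "confining_family X \<Phi> U \<noteq> {}"
      using topspace_in_confining_family[OF assms(3)] by blast
    show "\<Inter>(confining_family X \<Phi> U) \<subseteq> W"
      using omU \<open>A \<subseteq> W\<close> by (simp add: omega_limit_def)
  qed (use confining_family_Int[OF assms(3)] \<open>openin X W\<close>
        in \<open>auto simp: confining_family_def\<close>)
  then obtain K where K: "K \<in> confining_family X \<Phi> U" and "K \<subseteq> W" by blast
  then obtain T where "closedin X K" "confining X \<Phi> K" and T: "T > 0" "time_rel \<Phi> T `` U \<subseteq> K"
    by (auto simp: confining_family_def)
  have "A \<subseteq> K"
    using omU K by (auto simp: omega_limit_def)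
  have "normal_space X"
    using assms(1,2) by (simp add: compact_Hausdorff_or_regular_imp_normal_space)
  \<comment> \<open>The open set \<open>N\<close> leaves room around \<open>K\<close>: its closure
    will be \<open>B\<close>, with \<open>K\<close> in the interior.\<close>
  then obtain N where N: "openin X N" "K \<subseteq> N" "X closure_of N \<subseteq> W"
    using \<open>closedin X K\<close> \<open>openin X W\<close> \<open>K \<subseteq> W\<close> unfolding normal_space_alt by metis
  define B where "B = X closure_of N"
  have "closedin X B"
    by (simp add: B_def)
  have "K \<subseteq> X interior_of B"
    using N closure_of_subset[of N X] openin_subset[of X N] interior_of_maximal[of N B X]
    by (auto simp: B_def)
  have "A \<subseteq> B"
    using \<open>A \<subseteq> K\<close> \<open>K \<subseteq> X interior_of B\<close> interior_of_subset[of X B] by blast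
  have "B \<subseteq> U"
    using N(3) \<open>W \<subseteq> U\<close> by (simp add: B_def)
  \<comment> \<open>A squeeze: \<open>B \<subseteq> U\<close> bounds the limit set above by
    \<open>A\<close>, and invariance of \<open>A\<close> bounds it below.\<close>
  have "omega_limit X \<Phi> B = A"
    using omega_limit_mono[OF \<open>B \<subseteq> U\<close>] omU
      invariant_subset_omega_limit[OF inv \<open>A \<subseteq> B\<close>] by blast
  moreover have "eventually_strictly_confining X \<Phi> B"
  proof -
    \<comment> \<open>The entry time \<open>T\<close> of \<open>U\<close> into \<open>K\<close> also
      serves for \<open>B \<subseteq> U\<close>, and \<open>K\<close> is interior to
      \<open>B\<close>.\<close>
    have "time_rel \<Phi> t `` B \<subseteq> X interior_of B" if "t \<ge> T" for t
      using time_rel_Image_confining[OF assms(3) \<open>confining X \<Phi> K\<close> T(2) less_imp_le[OF T(1)] that]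
        \<open>B \<subseteq> U\<close> \<open>K \<subseteq> X interior_of B\<close> by blast
    then show ?thesis
      using T(1) closedin_subset[OF \<open>closedin X B\<close>]
      by (auto simp: eventually_strictly_confining_def)
  qed
  moreover have "neighborhood_of_set X A B"
    using \<open>A \<subseteq> K\<close> \<open>K \<subseteq> X interior_of B\<close> closedin_subset[OF \<open>closedin X B\<close>]
    by (auto simp: neighborhood_of_set_def)
  moreover have "compactin X B"
    using assms(1) \<open>closedin X B\<close> by (rule closedin_compact_space)
  ultimately show ?thesis
    using \<open>closedin X B\<close> N(3) \<open>W \<subseteq> V\<close> unfolding attracting_neighborhood_def B_def by blast
qed

end
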